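(* For underlay D2D, the operational region of Scheme 3-d (distance-based mode selection, D2D links always active) equals $$\mathcal R^{\text{3-d}}=\{\bar c_1>1\}.$$ Moreover the set $\hat{\mathcal R}^{\text{3-d}}$ of points of $\mathcal R^{\text{3-d}}$ for which the optimal mode selection probability satisfies $p^*<1$ is bounded as $\hat{\mathcal R}^{\text{3-d},(1)}\subseteq\hat{\mathcal R}^{\text{3-d}}\subseteq\hat{\mathcal R}^{\text{3-d},(2)}$, where for $\beta=1,2$ $$\hat{\mathcal R}^{\text{3-d},(\beta)}=\left\{1<\bar c_1<\frac{e^{\bar c_2+\bar c_3}}{1-\beta(\bar c_2+\bar c_3)},\ \bar c_2+\bar c_3<\frac1\beta\right\}\cup\left\{\bar c_1>1,\ \bar c_2+\bar c_3\ge\frac1\beta\right\}.$$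
   Context: A D2D-enabled cellular network has D2D mode selection probability $p\in(0,1]$; in Scheme 3 the D2D channel access probability is fixed to $1$. For underlay D2D with distance-based mode selection the average user rate is $R=R_{\mathrm{noD2D}}(1+wf(p))$ with $R_{\mathrm{noD2D}},w>0$ independent of $p$ and $$f(p)=\bar c_1p\,e^{-(\bar c_2p^2+\bar c_3p)}-p.$$ The operational point is encoded by $(\bar c_1,\bar c_2,\bar c_3)\in(0,\infty)^3$; all displayed sets are subsets of $(0,\infty)^3$. The operational region $\mathcal R^{\text{3-d}}$ is the set of operational points for which some $p\in(0,1]$ gives $R>R_{\mathrm{noD2D}}$, i.e. $f(p)>0$. $p^*$ is the maximizer of $R$ (equivalently of $f$) over $p\in(0,1]$. *)

theory Defs
  imports Complex_Main
begin

text \<open>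
  An operational point is a triple \<open>(c1, c2, c3)\<close> in the open positive octant; \<open>p\<close> is the mode
  selection probability, ranging over the half-open interval from 0 (excluded) to 1 (included).
  The constants \<open>Rno\<close> (the rate without D2D) and \<open>w\<close> do not depend on \<open>p\<close>, but they are allowed
  to vary with the operational point.
\<close>

type_synonym op_point = "real \<times> real \<times> real"

definition op_points :: "op_point set" where
  "op_points = {(c1, c2, c3). c1 > 0 \<and> c2 > 0 \<and> c3 > 0}"

fun rate_gain :: "op_point \<Rightarrow> real \<Rightarrow> real" where
  "rate_gain (c1, c2, c3) p = c1 * p * exp (- (c2 * p\<^sup>2 + c3 * p)) - p"

definition user_rate :: "(op_point \<Rightarrow> real) \<Rightarrow> (op_point \<Rightarrow> real) \<Rightarrow> op_point \<Rightarrow> real \<Rightarrow> real" where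
  "user_rate Rno w c p = Rno c * (1 + w c * rate_gain c p)"

definition operational_region :: "(op_point \<Rightarrow> real) \<Rightarrow> (op_point \<Rightarrow> real) \<Rightarrow> op_point set" where
  "operational_region Rno w =
     {c \<in> op_points. \<exists>p\<in>{0<..1}. user_rate Rno w c p > Rno c}"

text \<open>
  On the operational region the maximizer selected by \<^const>\<open>arg_max_on\<close> exists and is unique, see
  \<open>ex1_optimal_prob\<close> below; outside of it the value is irrelevant.
\<close>

definition optimal_prob :: "(op_point \<Rightarrow> real) \<Rightarrow> (op_point \<Rightarrow> real) \<Rightarrow> op_point \<Rightarrow> real" where
  "optimal_prob Rno w c = arg_max_on (user_rate Rno w c) {0<..1}"

definition partial_region :: "(op_point \<Rightarrow> real) \<Rightarrow> (op_point \<Rightarrow> real) \<Rightarrow> op_point set" where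
  "partial_region Rno w = {c \<in> operational_region Rno w. optimal_prob Rno w c < 1}"

definition bounding_region :: "real \<Rightarrow> op_point set" where
  "bounding_region \<beta> =
     {(c1, c2, c3) \<in> op_points.
        1 < c1 \<and> c1 < exp (c2 + c3) / (1 - \<beta> * (c2 + c3)) \<and> c2 + c3 < 1 / \<beta>}
     \<union> {(c1, c2, c3) \<in> op_points. c1 > 1 \<and> c2 + c3 \<ge> 1 / \<beta>}"

lemma ex1_maximizer_rate_gain:
  fixes c1 c2 c3 :: real
  assumes pos: "c1 > 0" "c2 > 0" "c3 > 0"
    and ex: "\<exists>p\<in>{0<..1}. rate_gain (c1, c2, c3) p > 0"
  shows "\<exists>!p. p \<in> {0<..1} \<and> (\<forall>q\<in>{0<..1}. rate_gain (c1, c2, c3) q \<le> rate_gain (c1, c2, c3) p)"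
proof -
  define f where "f = rate_gain (c1, c2, c3)"
  define E where "E = (\<lambda>p. c1 * exp (- (c2 * p\<^sup>2 + c3 * p)))"
  define k where "k = (\<lambda>p. 1 - p * (2 * c2 * p + c3))"
  have f_eq: "f p = c1 * p * exp (- (c2 * p\<^sup>2 + c3 * p)) - p" for p
    by (simp add: f_def)
  have deriv: "(f has_real_derivative E p * k p - 1) (at p)" for p
    unfolding f_eq[abs_def] E_def k_def
    by (rule derivative_eq_intros refl | simp add: algebra_simps power2_eq_square)+
  have cont: "continuous_on {0..1} f"
    unfolding f_eq[abs_def] by (intro continuous_intros)
  obtain m where m: "m \<in> {0..1}" "\<And>q. q \<in> {0..1} \<Longrightarrow> f q \<le> f m"
    using continuous_attains_sup[OF compact_Icc _ cont] by (metis atLeastAtMost_iff empty_iff zero_le_one order_refl)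
  obtain p0 where p0: "p0 \<in> {0<..1}" "f p0 > 0" using ex f_def by auto
  have "f m > 0" using m(2)[of p0] p0 by auto
  then have "m \<noteq> 0" by (auto simp: f_eq)
  then have ex_m: "m \<in> {0<..1} \<and> (\<forall>q\<in>{0<..1}. f q \<le> f m)"
    using m by auto
  have less: "f q < f p"
    if p: "p \<in> {0<..1}" and max: "\<forall>q\<in>{0<..1}. f q \<le> f p" and q: "q \<in> {0<..1}" and pq: "p < q"
    for p q
  proof -
    have "E p * k p - 1 = 0"
    proof (rule DERIV_local_max[OF deriv, of "min p (1 - p)"])
      show "0 < min p (1 - p)" using p q pq by auto
      show "\<forall>y. \<bar>p - y\<bar> < min p (1 - p) \<longrightarrow> f y \<le> f p"
        using max by (auto simp: abs_less_iff)
    qed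
    then have Ek: "E p * k p = 1" by simp
    have Epos: "E x > 0" for x using pos by (simp add: E_def)
    have kp: "k p > 0" using Ek Epos[of p] by (metis zero_less_mult_pos zero_less_one)
    have neg: "E x * k x - 1 < 0" if "p < x" for x
    proof -
      have sq: "p\<^sup>2 < x\<^sup>2" using that p by (intro power_strict_mono) auto
      have E_less: "E x < E p"
        using pos add_strict_mono[OF mult_strict_left_mono[OF sq pos(2)] mult_strict_left_mono[OF that pos(3)]]
        by (simp add: E_def)
      have k_le: "k x \<le> k p"
        unfolding k_def using pos that p by (intro diff_left_mono mult_mono add_mono) auto
      have "E x * k x \<le> E x * k p" using k_le Epos[of x] by simp
      also have "\<dots> < E p * k p" using E_less kp by simp
      finally show ?thesis using Ek by simp
    qed
    show ?thesis
    proof (rule DERIV_neg_imp_decreasing_open[OF pq])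
      show "\<exists>y. (f has_real_derivative y) (at x) \<and> y < 0" if "p < x" "x < q" for x
        using deriv neg[OF that(1)] by blast
      show "continuous_on {p..q} f"
        using p q by (intro continuous_on_subset[OF cont]) auto
    qed
  qed
  have "\<exists>!p. p \<in> {0<..1} \<and> (\<forall>q\<in>{0<..1}. f q \<le> f p)"
  proof (rule ex1I[of _ m])
    show "p = m" if p: "p \<in> {0<..1} \<and> (\<forall>q\<in>{0<..1}. f q \<le> f p)" for p
    proof (rule linorder_cases[of p m])
      assume "p < m"
      then have "f m < f p" using less[of p m] p ex_m by blast
      then show ?thesis using p ex_m by (meson not_less)
    next
      assume "m < p"
      then have "f p < f m" using less[of m p] p ex_m by blast
      then show ?thesis using p ex_m by (meson not_less)
    qed
  qed (rule ex_m)
  then show ?thesis by (simp add: f_def)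
qed

lemma ex1_optimal_prob:
  assumes "Rno c > 0" "w c > 0" "c \<in> operational_region Rno w"
  shows "\<exists>!p. is_arg_max (user_rate Rno w c) (\<lambda>p. p \<in> {0<..1}) p"
proof -
  obtain c1 c2 c3 where c: "c = (c1, c2, c3)" by (cases c) auto
  have le: "user_rate Rno w c q \<le> user_rate Rno w c p \<longleftrightarrow> rate_gain c q \<le> rate_gain c p" for p q
    using assms by (simp add: user_rate_def)
  have gt: "user_rate Rno w c p > Rno c \<longleftrightarrow> rate_gain c p > 0" for p
  proof -
    have "user_rate Rno w c p - Rno c = (Rno c * w c) * rate_gain c p"
      by (simp add: user_rate_def algebra_simps)
    then show ?thesis
      using assms(1,2) by (metis diff_gt_0_iff_gt mult_pos_pos zero_less_mult_pos)
  qed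
  have "c1 > 0" "c2 > 0" "c3 > 0"
    using assms(3) by (auto simp: c operational_region_def op_points_def)
  moreover have "\<exists>p\<in>{0<..1}. rate_gain (c1, c2, c3) p > 0"
    using assms(3) gt unfolding operational_region_def c by blast
  ultimately have "\<exists>!p. p \<in> {0<..1} \<and>
      (\<forall>q\<in>{0<..1}. rate_gain (c1, c2, c3) q \<le> rate_gain (c1, c2, c3) p)"
    by (rule ex1_maximizer_rate_gain)
  then show ?thesis
    unfolding is_arg_max_linorder le c[symmetric] by (simp add: Ball_def)
qed

end

theory Submission
  imports Defs
begin

text \<open>
  The derivative of the rate gain at \<open>p\<close> is \<open>E(p) k(p) - 1\<close> with
  \<open>E(p) = c1 exp (- (c2 p\<^sup>2 + c3 p))\<close> and \<open>k(p) = 1 - 2 c2 p\<^sup>2 - c3 p\<close>.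
  The lower bound makes it negative at \<open>p = 1\<close>, because \<open>k(1) < 1 - (c2 + c3)\<close>; so 1 is not optimal.
  Outside the upper bound, \<open>k(1) > 1 - 2 (c2 + c3)\<close> makes it positive at \<open>p = 1\<close>, and since both
  \<open>E\<close> and \<open>k\<close> decrease, it has no zero in the open unit interval.
\<close>

lemma DERIV_rate_gain:
  "(rate_gain (c1, c2, c3) has_real_derivative
     c1 * exp (- (c2 * p\<^sup>2 + c3 * p)) * (1 - p * (2 * c2 * p + c3)) - 1) (at p)"
  unfolding rate_gain.simps[abs_def]
  by (rule derivative_eq_intros refl | simp add: algebra_simps power2_eq_square)+

lemma user_rate_le_iff:
  assumes "Rno c > 0" "w c > 0"
  shows "user_rate Rno w c q \<le> user_rate Rno w c p \<longleftrightarrow> rate_gain c q \<le> rate_gain c p"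
  using assms by (simp add: user_rate_def)

lemma user_rate_gt_iff:
  assumes "Rno c > 0" "w c > 0"
  shows "user_rate Rno w c p > Rno c \<longleftrightarrow> rate_gain c p > 0"
proof -
  have "user_rate Rno w c p - Rno c = (Rno c * w c) * rate_gain c p"
    by (simp add: user_rate_def algebra_simps)
  then show ?thesis
    using assms by (metis diff_gt_0_iff_gt mult_pos_pos zero_less_mult_pos)
qed

lemma rate_gain_pos_iff:
  assumes "p > 0"
  shows "rate_gain (c1, c2, c3) p > 0 \<longleftrightarrow> c1 * exp (- (c2 * p\<^sup>2 + c3 * p)) > 1"
proof -
  have "rate_gain (c1, c2, c3) p = p * (c1 * exp (- (c2 * p\<^sup>2 + c3 * p)) - 1)"
    by (simp add: algebra_simps)
  then show ?thesis using assms by (simp add: zero_less_mult_iff)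
qed

text \<open>For \<open>p > 0\<close> the sign of the gain is that of
  \<open>c1 * exp (- (c2 * p\<^sup>2 + c3 * p)) - 1\<close>. The exponential is at most 1 and tends
  to 1 as \<open>p\<close> tends to 0, so small \<open>p\<close> decide.\<close>

lemma ex_rate_gain_pos_iff:
  assumes "c1 > 0" "c2 > 0" "c3 > 0"
  shows "(\<exists>p\<in>{0<..1}. rate_gain (c1, c2, c3) p > 0) \<longleftrightarrow> c1 > 1"
proof
  assume "\<exists>p\<in>{0<..1}. rate_gain (c1, c2, c3) p > 0"
  then obtain p where p: "p > 0" "rate_gain (c1, c2, c3) p > 0" by auto
  then have "1 < c1 * exp (- (c2 * p\<^sup>2 + c3 * p))"
    by (simp only: rate_gain_pos_iff)
  also have "\<dots> \<le> c1 * 1"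
    using assms p(1) by (intro mult_left_mono) (simp_all del: minus_add_distrib)
  finally show "c1 > 1" by simp
next
  assume c1: "c1 > 1"
  \<comment> \<open>By \<open>exp (- x) \<ge> 1 - x\<close> and \<open>p\<^sup>2 \<le> p\<close> it
    suffices that \<open>c1 * (1 - (c2 + c3) * p) > 1\<close>, that is,
    \<open>p < (c1 - 1) / (c1 * (c2 + c3))\<close>. The extra summand \<open>c1 - 1\<close> in the
    denominator makes this strict and also forces \<open>p \<le> 1\<close>.\<close>
  define d where "d = c1 * (c2 + c3) + (c1 - 1)"
  define p where "p = (c1 - 1) / d"
  have s: "c1 * (c2 + c3) > 0" using assms by simp
  then have d: "d > 0" using c1 by (simp add: d_def)
  then have p: "0 < p" "p \<le> 1" using c1 s by (simp_all add: p_def d_def)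
  have "c1 * (c2 + c3) * p = (c1 - 1) * (c1 * (c2 + c3) / d)" by (simp add: p_def)
  also have "\<dots> < (c1 - 1) * 1"
    using c1 d by (intro mult_strict_left_mono) (simp_all add: d_def)
  finally have "1 < c1 * (1 - (c2 + c3) * p)" by (simp add: algebra_simps)
  also have "\<dots> \<le> c1 * exp (- (c2 * p\<^sup>2 + c3 * p))"
  proof (rule mult_left_mono)
    have "p\<^sup>2 \<le> p" using p by (simp add: power2_eq_square mult_left_le)
    then have "c2 * p\<^sup>2 \<le> c2 * p" using assms by simp
    then have "1 - (c2 + c3) * p \<le> 1 + (- (c2 * p\<^sup>2 + c3 * p))" by (simp add: algebra_simps)
    also have "\<dots> \<le> exp (- (c2 * p\<^sup>2 + c3 * p))" by (rule exp_ge_add_one_self)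
    finally show "1 - (c2 + c3) * p \<le> exp (- (c2 * p\<^sup>2 + c3 * p))" .
  qed (use assms in simp)
  finally have "rate_gain (c1, c2, c3) p > 0" using p by (simp only: rate_gain_pos_iff)
  then show "\<exists>p\<in>{0<..1}. rate_gain (c1, c2, c3) p > 0" using p by force
qed

text \<open>\<open>arg_max_on\<close> is a choice operator, so the existence part of
  \<open>ex1_optimal_prob\<close> is what makes its value a maximizer. The rate is an increasing
  affine function of the gain, so both have the same maximizers.\<close>

lemma optimal_prob_maximizes:
  assumes "Rno c > 0" "w c > 0" "c \<in> operational_region Rno w"
  shows "optimal_prob Rno w c \<in> {0<..1}"
    and "q \<in> {0<..1} \<Longrightarrow> rate_gain c q \<le> rate_gain c (optimal_prob Rno w c)"
proof -
  have "is_arg_max (user_rate Rno w c) (\<lambda>p. p \<in> {0<..1}) (optimal_prob Rno w c)"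
    unfolding optimal_prob_def arg_max_on_def arg_max_def
    using ex1_optimal_prob[OF assms] by (meson someI_ex ex1_implies_ex)
  then show "optimal_prob Rno w c \<in> {0<..1}"
    and "q \<in> {0<..1} \<Longrightarrow> rate_gain c q \<le> rate_gain c (optimal_prob Rno w c)"
    using user_rate_le_iff[of Rno c w] assms(1,2) unfolding is_arg_max_linorder by blast+
qed

text \<open>A negative derivative at 1 means that the gain is larger just to the left of 1. The
  hypothesis avoids division so that it covers both pieces of
  \<open>bounding_region 1\<close>.\<close>

lemma one_not_maximizer:
  assumes "c1 > 0" "c2 > 0" "c1 * (1 - (c2 + c3)) < exp (c2 + c3)"
  shows "\<exists>q\<in>{0<..1}. rate_gain (c1, c2, c3) q > rate_gain (c1, c2, c3) 1"
proof -
  have "c1 * (1 - (2 * c2 + c3)) < c1 * (1 - (c2 + c3))" using assms by simp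
  then have "c1 * (1 - (2 * c2 + c3)) < exp (c2 + c3)" using assms(3) by linarith
  then have "c1 * exp (- (c2 * 1\<^sup>2 + c3 * 1)) * (1 - 1 * (2 * c2 * 1 + c3)) - 1 < 0"
    unfolding exp_minus by (simp add: field_simps)
  from DERIV_neg_dec_left[OF DERIV_rate_gain this] obtain d :: real where
    "d > 0" and d: "\<And>h. h > 0 \<Longrightarrow> h < d \<Longrightarrow> rate_gain (c1, c2, c3) 1 < rate_gain (c1, c2, c3) (1 - h)"
    by blast
  \<comment> \<open>The cap \<open>1 / 2\<close> keeps the point positive.\<close>
  then have "rate_gain (c1, c2, c3) 1 < rate_gain (c1, c2, c3) (1 - min (d / 2) (1 / 2))"
    by (intro d) auto
  then show ?thesis using \<open>d > 0\<close> by (intro bexI[of _ "1 - min (d / 2) (1 / 2)"]) auto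
qed

text \<open>The derivative vanishes at an interior maximizer, so \<open>E(p) k(p) = 1\<close>.
  Replacing \<open>E(p)\<close> by its smaller value at 1 and \<open>k(p)\<close> by the lower bound
  \<open>1 - 2 * (c2 + c3)\<close> makes the product strictly smaller than 1.\<close>

lemma interior_maximizer_bound:
  assumes pos: "c1 > 0" "c2 > 0" "c3 > 0"
    and p: "0 < p" "p < 1"
    and max: "\<And>q. q \<in> {0<..1} \<Longrightarrow> rate_gain (c1, c2, c3) q \<le> rate_gain (c1, c2, c3) p"
    and s: "2 * (c2 + c3) < 1"
  shows "c1 * (1 - 2 * (c2 + c3)) < exp (c2 + c3)"
proof -
  have sq: "p\<^sup>2 < 1" using p by (simp add: power_less_one_iff)
  have "c1 * exp (- (c2 * p\<^sup>2 + c3 * p)) * (1 - p * (2 * c2 * p + c3)) - 1 = 0"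
  proof (rule DERIV_local_max[OF DERIV_rate_gain, of "min p (1 - p)"])
    show "\<forall>y. \<bar>p - y\<bar> < min p (1 - p) \<longrightarrow> rate_gain (c1, c2, c3) y \<le> rate_gain (c1, c2, c3) p"
      using max by (auto simp: abs_less_iff simp del: rate_gain.simps)
  qed (use p in auto)
  then have Ek: "c1 * exp (- (c2 * p\<^sup>2 + c3 * p)) * (1 - p * (2 * c2 * p + c3)) = 1" by simp
  have E: "exp (- (c2 + c3)) < exp (- (c2 * p\<^sup>2 + c3 * p))"
    using add_strict_mono[OF mult_strict_left_mono[OF sq pos(2)] mult_strict_left_mono[OF p(2) pos(3)]]
    by simp
  have "p * (2 * c2 * p + c3) = 2 * (c2 * p\<^sup>2) + c3 * p"
    by (simp add: algebra_simps power2_eq_square)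
  also have "\<dots> \<le> 2 * c2 + c3"
    using pos p sq by (intro add_mono) (simp_all add: mult_left_le)
  \<comment> \<open>Giving up another \<open>c3\<close> leaves a bound in the sum
    \<open>c2 + c3\<close> alone.\<close>
  finally have k: "1 - 2 * (c2 + c3) \<le> 1 - p * (2 * c2 * p + c3)"
    using pos(3) by argo
  \<comment> \<open>Multiplying the two estimates stays strict because \<open>s\<close> makes the
    smaller second factor positive.\<close>
  have "c1 * exp (- (c2 + c3)) * (1 - 2 * (c2 + c3))
      < c1 * exp (- (c2 * p\<^sup>2 + c3 * p)) * (1 - p * (2 * c2 * p + c3))"
    using E k s pos by (intro mult_less_le_imp_less mult_strict_left_mono) auto
  then have "c1 * exp (- (c2 + c3)) * (1 - 2 * (c2 + c3)) < 1" using Ek by simp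
  then show ?thesis unfolding exp_minus by (simp add: field_simps)
qed

theorem proposition7:
  fixes Rno w :: "op_point \<Rightarrow> real"
  assumes "\<And>c. c \<in> op_points \<Longrightarrow> Rno c > 0"
    and "\<And>c. c \<in> op_points \<Longrightarrow> w c > 0"
  shows "operational_region Rno w = {(c1, c2, c3) \<in> op_points. c1 > 1}
    \<and> bounding_region 1 \<subseteq> partial_region Rno w
    \<and> partial_region Rno w \<subseteq> bounding_region 2"
proof -
  have region: "(c1, c2, c3) \<in> operational_region Rno w \<longleftrightarrow> (c1, c2, c3) \<in> op_points \<and> c1 > 1"
    for c1 c2 c3
  proof (cases "(c1, c2, c3) \<in> op_points")
    case True
    then have "(c1, c2, c3) \<in> operational_region Rno w
        \<longleftrightarrow> (\<exists>p\<in>{0<..1}. rate_gain (c1, c2, c3) p > 0)"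
      using user_rate_gt_iff[of Rno _ w, OF assms(1)[OF True] assms(2)[OF True]] unfolding operational_region_def by blast
    then show ?thesis
      using True ex_rate_gain_pos_iff[of c1 c2 c3] by (simp add: op_points_def)
  qed (simp add: operational_region_def)
  have lower: "(c1, c2, c3) \<in> partial_region Rno w" if "(c1, c2, c3) \<in> bounding_region 1" for c1 c2 c3
  proof -
    have c: "(c1, c2, c3) \<in> op_points" "c1 > 1" and
      s: "c1 < exp (c2 + c3) / (1 - (c2 + c3)) \<and> c2 + c3 < 1 \<or> c2 + c3 \<ge> 1"
      using that by (auto simp: bounding_region_def)
    \<comment> \<open>Clearing the denominator needs \<open>c2 + c3 < 1\<close>; otherwise the left
      side is at most 0.\<close>
    have "c1 * (1 - (c2 + c3)) < exp (c2 + c3)"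
    proof (cases "c2 + c3 < 1")
      case True
      then show ?thesis using s by (simp add: pos_less_divide_eq)
    next
      case False
      then have "c1 * (1 - (c2 + c3)) \<le> 0" using c by (simp add: mult_le_0_iff)
      then show ?thesis using exp_gt_zero[of "c2 + c3"] by linarith
    qed
    then obtain q where q: "q \<in> {0<..1}" "rate_gain (c1, c2, c3) q > rate_gain (c1, c2, c3) 1"
      using one_not_maximizer[of c1 c2 c3] c by (auto simp: op_points_def simp del: rate_gain.simps)
    have mem: "(c1, c2, c3) \<in> operational_region Rno w" using region c by simp
    note opt = optimal_prob_maximizes[of Rno _ w, OF assms(1)[OF c(1)] assms(2)[OF c(1)] mem]
    have "optimal_prob Rno w (c1, c2, c3) \<noteq> 1" using opt(2)[OF q(1)] q(2) by force
    then show ?thesis using opt(1) mem by (simp add: partial_region_def)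
  qed
  have upper: "(c1, c2, c3) \<in> bounding_region 2" if "(c1, c2, c3) \<in> partial_region Rno w" for c1 c2 c3
  proof -
    have mem: "(c1, c2, c3) \<in> operational_region Rno w" and
      less: "optimal_prob Rno w (c1, c2, c3) < 1"
      using that by (auto simp: partial_region_def)
    have c: "(c1, c2, c3) \<in> op_points" "c1 > 1" using mem region by auto
    note opt = optimal_prob_maximizes[of Rno _ w, OF assms(1)[OF c(1)] assms(2)[OF c(1)] mem]
    \<comment> \<open>If \<open>c2 + c3 \<ge> 1 / 2\<close>, the point lies in the second piece of
      \<open>bounding_region 2\<close> by \<open>c1 > 1\<close> alone.\<close>
    have "c1 < exp (c2 + c3) / (1 - 2 * (c2 + c3))" if s: "2 * (c2 + c3) < 1"
      using interior_maximizer_bound[of c1 c2 c3, OF _ _ _ _ less opt(2) s] opt(1) c s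
      by (simp add: op_points_def pos_less_divide_eq)
    then show ?thesis using c by (auto simp: bounding_region_def)
  qed
  show ?thesis using region lower upper by auto
qed

end
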